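(* Let $F$ be a field of characteristic not $2$. Let $L/F$ be an elementary abelian extension and $y\in L$ a biquadratic generator with minimal polynomial $P(X)=X^4+uX^2+w^2\in F[X]$ ($u,w\in F$). Let $L'/F$ be a biquadratic extension and $y'\in L'$ a biquadratic generator with minimal polynomial $Q(X)=X^4+vX^2+z^2\in F[X]$ ($v,z\in F$). Then $L/F$ and $L'/F$ are $F$-isomorphic if and only if at least one of the following holds: \begin{enumerate} \item $\frac{-v-2z}{-u+2w}\in F^2$ and $\frac{-v+2z}{-u-2w}\in F^2$; \item $\frac{-v-2z}{-u+2w}\in F^2$ and $\frac{-v+2z}{u^2-4w^2}\in F^2$; \item $\frac{-v-2z}{-u-2w}\in F^2$ and $\frac{-v+2z}{-u+2w}\in F^2$; \item $\frac{-v-2z}{-u-2w}\in F^2$ and $\frac{-v+2z}{u^2-4w^2}\in F^2$; \item $\frac{-v-2z}{u^2-4w^2}\in F^2$ and $\frac{-v+2z}{-u-2w}\in F^2$; \item $\frac{-v-2z}{u^2-4w^2}\in F^2$ and $\frac{-v+2z}{-u+2w}\in F^2$. \end{enumerate}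
   Context: $F$ is a field of characteristic different from $2$. A quartic extension is elementary abelian if it is Galois with Galois group $\mathbb{Z}/2\mathbb{Z}\times\mathbb{Z}/2\mathbb{Z}$. A quartic extension is biquadratic if it has a primitive element (biquadratic generator) with minimal polynomial of the form $X^4+uX^2+w$, $u,w\in F$. $F$-isomorphic means isomorphic via a ring isomorphism fixing $F$; $F^2$ is the set of squares in $F$. *)

theory Defs
  imports
    "HOL-Algebra.Elementary_Groups"
    "HOL-Computational_Algebra.Polynomial"
    "Jordan_Normal_Form.Char_Poly"
begin

text \<open>
  A field extension $L/F$ is an embedding \<open>\<iota>\<close> of the field \<open>'f\<close> into the field \<open>'l\<close>,
  i.e.\ \<open>\<iota>\<close> satisfies \<^const>\<open>field_hom\<close>; the base field inside $L$ is \<open>range \<iota>\<close>.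
\<close>

text \<open>The degree of an infinite extension is 0, by the convention of \<open>vector_space.dim\<close>.\<close>

definition ext_degree :: "('f::field \<Rightarrow> 'l::field) \<Rightarrow> nat" where
  "ext_degree \<iota> = vector_space.dim (\<lambda>a x. \<iota> a * x) (UNIV :: 'l set)"

definition is_subfield :: "'l::field set \<Rightarrow> bool" where
  "is_subfield K \<longleftrightarrow> 0 \<in> K \<and> 1 \<in> K \<and>
     (\<forall>x\<in>K. \<forall>y\<in>K. x + y \<in> K \<and> x * y \<in> K) \<and>
     (\<forall>x\<in>K. - x \<in> K \<and> inverse x \<in> K)"

definition adjoin :: "('f::field \<Rightarrow> 'l::field) \<Rightarrow> 'l \<Rightarrow> 'l set" where
  "adjoin \<iota> y = \<Inter>{K. is_subfield K \<and> range \<iota> \<subseteq> K \<and> y \<in> K}"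

definition primitive_element :: "('f::field \<Rightarrow> 'l::field) \<Rightarrow> 'l \<Rightarrow> bool" where
  "primitive_element \<iota> y \<longleftrightarrow> adjoin \<iota> y = UNIV"

definition is_min_poly :: "('f::field \<Rightarrow> 'l::field) \<Rightarrow> 'l \<Rightarrow> 'f poly \<Rightarrow> bool" where
  "is_min_poly \<iota> y p \<longleftrightarrow> lead_coeff p = 1 \<and> poly (map_poly \<iota> p) y = 0 \<and>
     (\<forall>q. q \<noteq> 0 \<longrightarrow> poly (map_poly \<iota> q) y = 0 \<longrightarrow> degree p \<le> degree q)"

definition field_aut_group :: "('f::field \<Rightarrow> 'l::field) \<Rightarrow> ('l \<Rightarrow> 'l) monoid" where
  "field_aut_group \<iota> =
     \<lparr>carrier = {\<sigma>. field_isom \<sigma> \<and> (\<forall>a. \<sigma> (\<iota> a) = \<iota> a)}, monoid.mult = (\<circ>), one = id\<rparr>"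

definition finite_galois :: "('f::field \<Rightarrow> 'l::field) \<Rightarrow> bool" where
  "finite_galois \<iota> \<longleftrightarrow> ext_degree \<iota> > 0 \<and>
     {x. \<forall>\<sigma>\<in>carrier (field_aut_group \<iota>). \<sigma> x = x} = range \<iota>"

definition elementary_abelian_ext :: "('f::field \<Rightarrow> 'l::field) \<Rightarrow> bool" where
  "elementary_abelian_ext \<iota> \<longleftrightarrow> ext_degree \<iota> = 4 \<and> finite_galois \<iota> \<and>
     field_aut_group \<iota> \<cong> integer_mod_group 2 \<times>\<times> integer_mod_group 2"

definition biquadratic_generator :: "('f::field \<Rightarrow> 'l::field) \<Rightarrow> 'l \<Rightarrow> bool" where
  "biquadratic_generator \<iota> y \<longleftrightarrow>
     primitive_element \<iota> y \<and> (\<exists>u w. is_min_poly \<iota> y [:w, 0, u, 0, 1:])"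

definition biquadratic_ext :: "('f::field \<Rightarrow> 'l::field) \<Rightarrow> bool" where
  "biquadratic_ext \<iota> \<longleftrightarrow> ext_degree \<iota> = 4 \<and> (\<exists>y. biquadratic_generator \<iota> y)"

definition ext_isomorphic ::
    "('f::field \<Rightarrow> 'l::field) \<Rightarrow> ('f \<Rightarrow> 'm::field) \<Rightarrow> bool" where
  "ext_isomorphic \<iota> \<iota>' \<longleftrightarrow> (\<exists>\<phi>. field_isom \<phi> \<and> (\<forall>a. \<phi> (\<iota> a) = \<iota>' a))"

definition squares :: "'f::field set" where
  "squares = range (\<lambda>x. x ^ 2)"

end

theory Submission
  imports Defs
begin

text \<open>
  From $y^2 + w^2/y^2 = -u$ one gets $(y \pm w/y)^2 = -u \pm 2w$, so $L$ is generated by square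
  roots $\alpha, \beta$ of $a = -u + 2w$ and $b = -u - 2w$, and $1, \alpha, \beta, \alpha\beta$ is a
  basis because $y$ is not a root of a quadratic polynomial. Expanding in this basis, the nonsquares
  of $F$ that become squares in $L$ are those in the square classes of $a$, $b$ and $ab$. Hence
  $L \cong L'$ iff the corresponding elements $a', b'$ of $L'$ lie in two different
  ones of these three classes, and the six conditions enumerate the possibilities.
\<close>

section \<open>Subfields and the adjunction of one square root\<close>

lemma is_subfieldI:
  assumes "0 \<in> K" "1 \<in> K" "\<And>x y. x \<in> K \<Longrightarrow> y \<in> K \<Longrightarrow> x + y \<in> K \<and> x * y \<in> K"
    and "\<And>x. x \<in> K \<Longrightarrow> - x \<in> K" "\<And>x. x \<in> K \<Longrightarrow> inverse x \<in> K"
  shows "is_subfield K"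
  using assms by (simp add: is_subfield_def)

lemma is_subfield_minus_divide: "is_subfield K \<Longrightarrow> x \<in> K \<Longrightarrow> y \<in> K \<Longrightarrow> - x * inverse y \<in> K"
  by (simp add: is_subfield_def)

text \<open>Inverses exist because \<open>p + q * \<gamma>\<close> times its conjugate
  \<open>p - q * \<gamma>\<close> is a norm in \<open>K\<close>. Applied twice, first with \<alpha>
  and then with \<beta>, this shows that the span of the four products of square roots is a
  field.\<close>

lemma quadratic_adjoin_subfield:
  fixes \<gamma> :: "'l::field"
  assumes K: "is_subfield K" and g: "\<gamma> ^ 2 \<in> K"
  shows "is_subfield {p + q * \<gamma> | p q. p \<in> K \<and> q \<in> K}" (is "is_subfield ?E")
proof -
  have add: "x + y \<in> K" and mult: "x * y \<in> K" if "x \<in> K" "y \<in> K" for x y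
    using K that by (auto simp: is_subfield_def)
  have uminus: "- x \<in> K" and inv: "inverse x \<in> K" if "x \<in> K" for x
    using K that by (auto simp: is_subfield_def)
  have zero: "0 \<in> K" and one: "1 \<in> K" using K by (auto simp: is_subfield_def)
  have E: "p + q * \<gamma> \<in> ?E" if "p \<in> K" "q \<in> K" for p q using that by blast
  have "inverse (p + q * \<gamma>) \<in> ?E" if p: "p \<in> K" and q: "q \<in> K" for p q
  proof (cases "p - q * \<gamma> = 0")
    \<comment> \<open>A vanishing conjugate means that either \<open>p\<close> and \<open>q\<close>
      are both 0, where \<open>inverse 0 = 0\<close> applies, or \<gamma> itself lies in
      \<open>K\<close>.\<close>
    case True
    show ?thesis
    proof (cases "q = 0")
      case True
      then show ?thesis using E[OF inv[OF p] zero] by simp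
    next
      case False
      then have "\<gamma> = p * inverse q" using True by (simp add: field_simps)
      then have "\<gamma> \<in> K" using mult[OF p inv[OF q]] by simp
      then have "inverse (p + q * \<gamma>) \<in> K" using add mult inv p q by blast
      then show ?thesis using E[OF _ zero] by simp
    qed
  next
    case False
    \<comment> \<open>\<open>N\<close> is the inverse of the norm. If
      \<open>p + q * \<gamma> = 0\<close>, the computation stays valid by
      \<open>inverse 0 = 0\<close>.\<close>
    define N where "N = inverse (p * p + - (q * q * \<gamma> ^ 2))"
    have N: "N \<in> K" unfolding N_def by (intro inv add mult uminus p q g)
    have "p * p + - (q * q * \<gamma> ^ 2) = (p + q * \<gamma>) * (p - q * \<gamma>)"
      by (simp add: algebra_simps power2_eq_square)
    then have "N = inverse (p + q * \<gamma>) * inverse (p - q * \<gamma>)" unfolding N_def by simp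
    then have "(p - q * \<gamma>) * N = inverse (p + q * \<gamma>)" using False by simp
    then have "inverse (p + q * \<gamma>) = p * N + - (q * N) * \<gamma>" by (simp add: algebra_simps)
    then show ?thesis using E[of "p * N" "- (q * N)"] mult uminus N p q by simp
  qed
  then have inverse_E: "inverse x \<in> ?E" if "x \<in> ?E" for x using that by blast
  have uminus_E: "- x \<in> ?E" if "x \<in> ?E" for x
  proof -
    from that obtain p q where "p \<in> K" "q \<in> K" and x: "x = p + q * \<gamma>" by blast
    then show "- x \<in> ?E" using E[of "- p" "- q"] uminus by simp
  qed
  have add_mult_E: "x + y \<in> ?E \<and> x * y \<in> ?E" if x: "x \<in> ?E" and y: "y \<in> ?E" for x y
  proof -
    obtain p q where pq: "p \<in> K" "q \<in> K" and x': "x = p + q * \<gamma>" using x by blast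
    obtain r s where rs: "r \<in> K" "s \<in> K" and y': "y = r + s * \<gamma>" using y by blast
    have "x + y = (p + r) + (q + s) * \<gamma>" by (simp add: x' y' algebra_simps)
    moreover have "x * y = (p * r + q * s * \<gamma> ^ 2) + (p * s + q * r) * \<gamma>"
      by (simp add: x' y' algebra_simps power2_eq_square)
    ultimately show ?thesis
      using E[of "p + r" "q + s"] E[of "p * r + q * s * \<gamma> ^ 2" "p * s + q * r"] add mult pq rs g
      by simp
  qed
  have "0 \<in> ?E" "1 \<in> ?E" using E[OF zero zero] E[OF one zero] by simp_all
  from is_subfieldI[OF this add_mult_E uminus_E inverse_E] show ?thesis .
qed

lemma (in field_hom) is_subfield_range: "is_subfield (range hom)"
  unfolding is_subfield_def
  by (auto simp flip: hom_add hom_mult hom_uminus hom_inverse intro: rev_image_eqI[of 0] rev_image_eqI[of 1])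

section \<open>Square classes and the characteristic\<close>

lemma mem_squares_divide_iff:
  fixes c d :: "'f::field"
  assumes "d \<noteq> 0"
  shows "c / d \<in> squares \<longleftrightarrow> (\<exists>t. c = d * t ^ 2)"
  using assms by (auto simp: squares_def field_simps)

lemma two_neq_zero_if_CHAR:
  assumes "CHAR('f::field) \<noteq> 2"
  shows "(2 :: 'f) \<noteq> 0"
proof
  assume "(2 :: 'f) = 0"
  then have "of_nat 2 = (0 :: 'f)" by simp
  then have "CHAR('f) dvd 2" by (simp only: of_nat_eq_0_iff_char_dvd)
  moreover have "CHAR('f) \<noteq> 1" by simp
  ultimately show False using assms
    by (metis One_nat_def dvd_imp_le le_neq_implies_less less_2_cases dvd_0_left_iff zero_less_numeral zero_neq_numeral)
qed

section \<open>Extensions with a basis of square roots\<close>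

text \<open>Both L and L' turn out to be instances. Stating independence and span by coefficients in
  the base field reduces identities in the extension to comparing four coordinates.\<close>

locale sqrt_basis = field_hom \<iota> for \<iota> :: "'f::field \<Rightarrow> 'l::field" +
  fixes \<alpha> \<beta> :: 'l and a b :: 'f
  assumes two_neq_zero: "(2 :: 'f) \<noteq> 0"
    and alpha_sq: "\<alpha> ^ 2 = \<iota> a" and beta_sq: "\<beta> ^ 2 = \<iota> b"
    and indep: "\<iota> p + \<iota> q * \<alpha> + \<iota> r * \<beta> + \<iota> s * (\<alpha> * \<beta>) = 0 \<Longrightarrow> p = 0 \<and> q = 0 \<and> r = 0 \<and> s = 0"
    and span: "\<exists>p q r s. x = \<iota> p + \<iota> q * \<alpha> + \<iota> r * \<beta> + \<iota> s * (\<alpha> * \<beta>)"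
begin

text \<open>The coordinates form one tuple so that a single \<open>THE\<close> can recover them in
  \<open>hom_extension\<close>.\<close>

definition comb :: "'f \<times> 'f \<times> 'f \<times> 'f \<Rightarrow> 'l" where
  "comb = (\<lambda>(p, q, r, s). \<iota> p + \<iota> q * \<alpha> + \<iota> r * \<beta> + \<iota> s * (\<alpha> * \<beta>))"

lemma comb_eq_iff: "comb (p, q, r, s) = comb (p', q', r', s') \<longleftrightarrow> p = p' \<and> q = q' \<and> r = r' \<and> s = s'"
proof
  assume "comb (p, q, r, s) = comb (p', q', r', s')"
  then have "\<iota> (p - p') + \<iota> (q - q') * \<alpha> + \<iota> (r - r') * \<beta> + \<iota> (s - s') * (\<alpha> * \<beta>) = 0"
    by (simp add: comb_def hom_minus algebra_simps)
  from indep[OF this] show "p = p' \<and> q = q' \<and> r = r' \<and> s = s'" by simp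
qed simp

lemma comb_mult:
  "comb (p, q, r, s) * comb (p', q', r', s') =
   comb (p * p' + q * q' * a + r * r' * b + s * s' * a * b,
         p * q' + q * p' + (r * s' + s * r') * b,
         p * r' + r * p' + (q * s' + s * q') * a,
         p * s' + s * p' + q * r' + r * q')"
  unfolding comb_def prod.case hom_add hom_mult alpha_sq[symmetric] beta_sq[symmetric]
  by (simp add: algebra_simps power2_eq_square)

text \<open>Otherwise \<alpha> would be \<open>\<iota> t\<close> or its negative, against uniqueness
  of coordinates. The same argument with \<beta> and \<open>\<alpha> * \<beta>\<close> handles
  \<open>b\<close> and \<open>a * b\<close>.\<close>

lemma a_not_square: "a \<noteq> t ^ 2"
proof
  assume "a = t ^ 2"
  then have "comb (0, 1, 0, 0) ^ 2 = comb (t, 0, 0, 0) ^ 2"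
    by (simp add: comb_def alpha_sq hom_power)
  then have "comb (0, 1, 0, 0) = comb (t, 0, 0, 0) \<or> comb (0, 1, 0, 0) = comb (- t, 0, 0, 0)"
    by (simp add: power2_eq_iff comb_def hom_uminus)
  then show False by (simp add: comb_eq_iff)
qed

lemma b_not_square: "b \<noteq> t ^ 2"
proof
  assume "b = t ^ 2"
  then have "comb (0, 0, 1, 0) ^ 2 = comb (t, 0, 0, 0) ^ 2"
    by (simp add: comb_def beta_sq hom_power)
  then have "comb (0, 0, 1, 0) = comb (t, 0, 0, 0) \<or> comb (0, 0, 1, 0) = comb (- t, 0, 0, 0)"
    by (simp add: power2_eq_iff comb_def hom_uminus)
  then show False by (simp add: comb_eq_iff)
qed

lemma ab_not_square: "a * b \<noteq> t ^ 2"
proof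
  assume "a * b = t ^ 2"
  then have "\<iota> a * \<iota> b = \<iota> t ^ 2" by (simp flip: hom_mult hom_power)
  then have "comb (0, 0, 0, 1) ^ 2 = comb (t, 0, 0, 0) ^ 2"
    by (simp add: comb_def alpha_sq beta_sq power_mult_distrib)
  then have "comb (0, 0, 0, 1) = comb (t, 0, 0, 0) \<or> comb (0, 0, 0, 1) = comb (- t, 0, 0, 0)"
    by (simp add: power2_eq_iff comb_def hom_uminus)
  then show False by (simp add: comb_eq_iff)
qed

lemma a_neq_zero: "a \<noteq> 0" and b_neq_zero: "b \<noteq> 0"
  using a_not_square[of 0] b_not_square[of 0] by simp_all

text \<open>Since \<open>x ^ 2\<close> lies in the base field, its coefficients at \<alpha>, \<beta>
  and \<open>\<alpha> * \<beta>\<close> vanish. This leaves \<open>x\<close> a multiple of one basis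
  element, which is not 1 because \<open>c\<close> is not a square.\<close>

lemma sqrt_class:
  assumes x: "x ^ 2 = \<iota> c" and c: "\<And>t. c \<noteq> t ^ 2"
  obtains t where "c = a * t ^ 2" | t where "c = b * t ^ 2" | t where "c = a * b * t ^ 2"
proof -
  obtain p q r s where xe: "x = comb (p, q, r, s)" using span[of x] by (auto simp: comb_def)
  have "comb (p, q, r, s) * comb (p, q, r, s) = comb (c, 0, 0, 0)"
    using x xe by (simp add: power2_eq_square) (simp add: comb_def)
  then have eqs: "p * p + q * q * a + r * r * b + s * s * a * b = c"
    "2 * (p * q + r * s * b) = 0" "2 * (p * r + q * s * a) = 0" "2 * (p * s + q * r) = 0"
    by (simp_all add: comb_mult comb_eq_iff algebra_simps)
  from eqs(2-4) have e1: "p * q + r * s * b = 0" and e2: "p * r + q * s * a = 0"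
    and e3: "p * s + q * r = 0" using two_neq_zero by (metis mult_eq_0_iff)+
  have p: "p = 0"
  proof (rule ccontr)
    assume p: "p \<noteq> 0"
    \<comment> \<open>This is \<open>p\<close> times \<open>e1\<close> minus \<open>s * b\<close>
      times \<open>e2\<close>. The second factor is nonzero since \<open>a * b\<close> is not a
      square, so \<open>q\<close>, then \<open>r\<close> and \<open>s\<close>, vanish and
      \<open>c = p ^ 2\<close>.\<close>
    have "q * (p ^ 2 - s ^ 2 * (a * b)) = 0" using e1 e2 by Groebner_Basis.algebra
    moreover have "p ^ 2 - s ^ 2 * (a * b) \<noteq> 0"
    proof (cases "s = 0")
      case False
      then show ?thesis using ab_not_square[of "p / s"] by (auto simp: field_simps)
    qed (use p in simp)
    ultimately have "q = 0" by simp
    then have "r = 0" "s = 0" using e2 e3 p by auto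
    then show False using eqs(1) c[of p] \<open>q = 0\<close> by (simp add: power2_eq_square)
  qed
  then have "r * s = 0" "q * s = 0" "q * r = 0" using e1 e2 e3 a_neq_zero b_neq_zero by auto
  \<comment> \<open>The pairwise products vanish, so at most one of \<open>q\<close>,
    \<open>r\<close>, \<open>s\<close> is nonzero; its square is the factor relating
    \<open>c\<close> to its class.\<close>
  then consider "r = 0" "s = 0" | "q = 0" "s = 0" | "q = 0" "r = 0" by auto
  then show thesis
  proof cases
    case 1 then show thesis using eqs(1) p that(1)[of q] by (simp add: power2_eq_square ac_simps)
  next
    case 2 then show thesis using eqs(1) p that(2)[of r] by (simp add: power2_eq_square ac_simps)
  next
    case 3 then show thesis using eqs(1) p that(3)[of s] by (simp add: power2_eq_square ac_simps)
  qed
qed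

text \<open>The multiplication table of the basis involves only \<open>a\<close> and
  \<open>b\<close>, so sending \<alpha> to \<open>A\<close> and \<beta> to \<open>B\<close> respects
  products.\<close>

lemma hom_extension:
  fixes \<iota>' :: "'f \<Rightarrow> 'm::field"
  assumes "field_hom \<iota>'" and A: "A ^ 2 = \<iota>' a" and B: "B ^ 2 = \<iota>' b"
  obtains \<phi> where "field_hom \<phi>" "\<And>c. \<phi> (\<iota> c) = \<iota>' c"
proof -
  interpret h: field_hom \<iota>' by fact
  define comb' where
    "comb' = (\<lambda>(p, q, r, s). \<iota>' p + \<iota>' q * A + \<iota>' r * B + \<iota>' s * (A * B))"
  define \<phi> where "\<phi> x = comb' (THE t. comb t = x)" for x
  have \<phi>: "\<phi> (comb t) = comb' t" for t
  proof -
    have "(THE t'. comb t' = comb t) = t" by (cases t) (auto simp: comb_eq_iff)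
    then show ?thesis by (simp add: \<phi>_def)
  qed
  have \<iota>: "\<iota> c = comb (c, 0, 0, 0)" for c by (simp add: comb_def)
  have const: "\<phi> (\<iota> c) = \<iota>' c" for c unfolding \<iota> \<phi> by (simp add: comb'_def)
  have "\<phi> (x + y) = \<phi> x + \<phi> y \<and> \<phi> (x * y) = \<phi> x * \<phi> y" for x y
  proof -
    obtain p q r s where x: "x = comb (p, q, r, s)" using span[of x] by (auto simp: comb_def)
    obtain p' q' r' s' where y: "y = comb (p', q', r', s')" using span[of y] by (auto simp: comb_def)
    have "x + y = comb (p + p', q + q', r + r', s + s')"
      by (simp add: x y comb_def hom_add algebra_simps)
    then have "\<phi> (x + y) = \<phi> x + \<phi> y"
      by (simp add: x y \<phi> comb'_def h.hom_add algebra_simps)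
    moreover have "\<phi> (x * y) = \<phi> x * \<phi> y"
      \<comment> \<open>Writing the images of \<open>a\<close> and \<open>b\<close> as
        \<open>A ^ 2\<close> and \<open>B ^ 2\<close> turns the claim into a polynomial
        identity.\<close>
      unfolding x y comb_mult \<phi> comb'_def prod.case h.hom_add h.hom_mult A[symmetric] B[symmetric]
      by (simp add: algebra_simps power2_eq_square)
    ultimately show ?thesis by simp
  qed
  moreover have "\<phi> 0 = 0" "\<phi> 1 = 1" using const[of 0] const[of 1] by simp_all
  ultimately have "field_hom \<phi>" by unfold_locales auto
  then show thesis using const that by blast
qed

end

section \<open>The basis obtained from a biquadratic generator\<close>

text \<open>Independence is proved along the tower: \<alpha> is not in F and \<beta> is not in
  F(\<alpha>), since either would give \<open>y\<close> a quadratic equation. Spanning holds because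
  the span is a subfield containing \<open>y\<close>.\<close>

lemma sqrt_basis_of_min_poly:
  fixes \<iota> :: "'f::field \<Rightarrow> 'l::field"
  assumes two: "(2 :: 'f) \<noteq> 0" and "field_hom \<iota>" and prim: "primitive_element \<iota> y"
    and mp: "is_min_poly \<iota> y [:w^2, 0, u, 0, 1:]"
  shows "sqrt_basis \<iota> (y + \<iota> w / y) (y - \<iota> w / y) (- u + 2 * w) (- u - 2 * w)"
proof -
  interpret field_hom \<iota> by fact
  have hom2: "\<iota> 2 = 2" using hom_add[of 1 1] by simp
  have two': "(2 :: 'l) \<noteq> 0" using two hom2 by (metis hom_0_iff)
  have no_quadratic: "y ^ 2 + \<iota> d * y + \<iota> c \<noteq> 0" for c d
  proof
    assume "y ^ 2 + \<iota> d * y + \<iota> c = 0"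
    then have "poly (map_poly \<iota> [:c, d, 1:]) y = 0"
      by (simp add: map_poly_pCons algebra_simps power2_eq_square)
    then have "degree [:w^2, 0, u, 0, 1:] \<le> degree [:c, d, 1:]"
      using mp unfolding is_min_poly_def by (metis pCons_eq_0_iff zero_neq_one)
    then show False by simp
  qed
  have quartic: "y ^ 4 + \<iota> u * y ^ 2 + \<iota> w ^ 2 = 0"
    using mp unfolding is_min_poly_def
    by (simp add: map_poly_pCons algebra_simps power2_eq_square power4_eq_xxxx hom_mult)
  have y: "y \<noteq> 0" using no_quadratic[of 0 0] by auto
  define \<alpha> where "\<alpha> = y + \<iota> w / y"
  define \<beta> where "\<beta> = y - \<iota> w / y"
  define a where "a = - u + 2 * w"
  define b where "b = - u - 2 * w"
  have prod: "y * (\<iota> w / y) = \<iota> w" using y by simp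
  \<comment> \<open>The quartic equation, prepared for cancelling \<open>y ^ 2\<close>. The cross
    terms of the squares of \<alpha> and \<beta> then contribute \<open>2 * w\<close> and
    \<open>- 2 * w\<close>.\<close>
  have "y ^ 2 * (y ^ 2 + (\<iota> w / y) ^ 2) = y ^ 2 * (- \<iota> u)"
    using quartic prod by Groebner_Basis.algebra
  then have sum_sq: "y ^ 2 + (\<iota> w / y) ^ 2 = - \<iota> u" using y by (metis mult_cancel_left power_not_zero)
  have alpha_sq: "\<alpha> ^ 2 = \<iota> a"
    using sum_sq prod unfolding \<alpha>_def a_def hom_add hom_uminus hom_mult hom2 by Groebner_Basis.algebra
  have beta_sq: "\<beta> ^ 2 = \<iota> b"
    using sum_sq prod unfolding \<beta>_def b_def hom_minus hom_uminus hom_mult hom2 by Groebner_Basis.algebra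
  have y_eq: "2 * y = \<alpha> + \<beta>" by (simp add: \<alpha>_def \<beta>_def)
  have alpha_notin: "\<alpha> \<noteq> \<iota> c" for c
  proof
    assume "\<alpha> = \<iota> c"
    then have "y ^ 2 + \<iota> (- c) * y + \<iota> w = 0"
      using y unfolding \<alpha>_def hom_uminus by (simp add: field_simps power2_eq_square)
    then show False using no_quadratic by blast
  qed
  have beta_notin: "\<beta> \<noteq> \<iota> c + \<iota> d * \<alpha>" for c d
  proof
    assume *: "\<beta> = \<iota> c + \<iota> d * \<alpha>"
    \<comment> \<open>Substituting \<beta> into \<open>2 * y = \<alpha> + \<beta>\<close> gives
      \<open>y = e + f * \<alpha>\<close>, hence the quadratic equation
      \<open>(y - e) ^ 2 = f ^ 2 * a\<close>.\<close>
    define e where "e = c / 2"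
    define f where "f = (1 + d) / 2"
    have "2 * y = 2 * (\<iota> e + \<iota> f * \<alpha>)"
      using two two' unfolding y_eq * e_def f_def by (simp add: hom_div hom_add hom2 field_simps)
    then have "y = \<iota> e + \<iota> f * \<alpha>" using two' by (metis mult_cancel_left)
    then have "y ^ 2 + \<iota> (- 2 * e) * y + \<iota> (e ^ 2 - f ^ 2 * a) = 0"
      using alpha_sq unfolding hom_minus hom_mult hom_uminus hom_power hom2 by Groebner_Basis.algebra
    then show False using no_quadratic by blast
  qed
  show ?thesis unfolding \<alpha>_def[symmetric] \<beta>_def[symmetric] a_def[symmetric] b_def[symmetric]
  proof
    fix p q r s
    assume *: "\<iota> p + \<iota> q * \<alpha> + \<iota> r * \<beta> + \<iota> s * (\<alpha> * \<beta>) = 0"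
    have lin: "c = 0 \<and> d = 0" if cd: "\<iota> c + \<iota> d * \<alpha> = 0" for c d
    proof (cases "d = 0")
      case False
      then have "\<alpha> = \<iota> (- c / d)" using cd by (simp add: hom_div hom_uminus field_simps eq_neg_iff_add_eq_0)
      then show ?thesis using alpha_notin by blast
    qed (use cd in simp)
    \<comment> \<open>Otherwise the relation could be solved for \<beta>, placing it in
      F(\<alpha>).\<close>
    have rs: "\<iota> r + \<iota> s * \<alpha> = 0"
    proof (rule ccontr)
      assume nz: "\<iota> r + \<iota> s * \<alpha> \<noteq> 0"
      let ?K = "{x + x' * \<alpha> | x x'. x \<in> range \<iota> \<and> x' \<in> range \<iota>}"
      have K: "is_subfield ?K"
        by (rule quadratic_adjoin_subfield) (use is_subfield_range alpha_sq in auto)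
      have "- (\<iota> p + \<iota> q * \<alpha>) * inverse (\<iota> r + \<iota> s * \<alpha>) = \<beta>"
        using nz * by (simp add: field_simps) Groebner_Basis.algebra
      moreover have "- (\<iota> p + \<iota> q * \<alpha>) * inverse (\<iota> r + \<iota> s * \<alpha>) \<in> ?K"
        by (rule is_subfield_minus_divide[OF K]) blast+
      ultimately have "\<beta> \<in> ?K" by (simp only:)
      then show False using beta_notin by blast
    qed
    then have "\<iota> p + \<iota> q * \<alpha> = 0" using * by Groebner_Basis.algebra
    then show "p = 0 \<and> q = 0 \<and> r = 0 \<and> s = 0" using lin rs by blast
  next
    fix x
    let ?K = "{x + x' * \<alpha> | x x'. x \<in> range \<iota> \<and> x' \<in> range \<iota>}"
    \<comment> \<open>\<open>?E\<close> is the span, built in two quadratic steps to be recognised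
      as a subfield; it contains \<open>y\<close>, half the sum of \<alpha> and \<beta>.\<close>
    let ?E = "{x + x' * \<beta> | x x'. x \<in> ?K \<and> x' \<in> ?K}"
    have K: "is_subfield ?K"
      by (rule quadratic_adjoin_subfield) (use is_subfield_range alpha_sq in auto)
    have K_I: "\<iota> c + \<iota> d * \<alpha> \<in> ?K" for c d by blast
    have K_range: "\<iota> c \<in> ?K" for c using K_I[of c 0] by simp
    have E: "is_subfield ?E"
      by (rule quadratic_adjoin_subfield[OF K]) (use beta_sq K_range in auto)
    have E_I: "k + l * \<beta> \<in> ?E" if "k \<in> ?K" "l \<in> ?K" for k l using that by blast
    have "range \<iota> \<subseteq> ?E" using E_I[OF K_range K_range[of 0]] by auto
    moreover have "y = (\<iota> 0 + \<iota> (1 / 2) * \<alpha>) + \<iota> (1 / 2) * \<beta>"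
      using y_eq two' by (simp add: hom_div hom2 field_simps)
    then have "y \<in> ?E" using E_I[OF K_I[of 0 "1 / 2"] K_range[of "1 / 2"]] by (simp only:)
    ultimately have "adjoin \<iota> y \<subseteq> ?E" unfolding adjoin_def using E by (intro Inter_lower) simp
    then have "x \<in> ?E" using prim unfolding primitive_element_def by blast
    then obtain p q r s where "x = (\<iota> p + \<iota> q * \<alpha>) + (\<iota> r + \<iota> s * \<alpha>) * \<beta>" by blast
    then have "x = \<iota> p + \<iota> q * \<alpha> + \<iota> r * \<beta> + \<iota> s * (\<alpha> * \<beta>)" by (simp add: algebra_simps)
    then show "\<exists>p q r s. x = \<iota> p + \<iota> q * \<alpha> + \<iota> r * \<beta> + \<iota> s * (\<alpha> * \<beta>)" by blast
  qed (use two alpha_sq beta_sq in auto)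
qed

section \<open>Isomorphism in terms of square classes\<close>

text \<open>The disjuncts are the ordered pairs of distinct classes among \<open>a\<close>,
  \<open>b\<close>, \<open>a * b\<close>, for \<open>b'\<close> and \<open>a'\<close>. Conversely,
  two such classes give roots of \<open>a\<close> and \<open>b\<close> in L', hence a homomorphism
  from L, whose image contains \<alpha>' and \<beta>'.\<close>

lemma ext_isomorphic_iff_square_classes:
  fixes \<iota> :: "'f::field \<Rightarrow> 'l::field" and \<iota>' :: "'f \<Rightarrow> 'm::field"
  assumes "sqrt_basis \<iota> \<alpha> \<beta> a b" and "sqrt_basis \<iota>' \<alpha>' \<beta>' a' b'"
  shows "ext_isomorphic \<iota> \<iota>' \<longleftrightarrow>
      b' / a \<in> squares \<and> a' / b \<in> squares
    \<or> b' / a \<in> squares \<and> a' / (a * b) \<in> squares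
    \<or> b' / b \<in> squares \<and> a' / a \<in> squares
    \<or> b' / b \<in> squares \<and> a' / (a * b) \<in> squares
    \<or> b' / (a * b) \<in> squares \<and> a' / b \<in> squares
    \<or> b' / (a * b) \<in> squares \<and> a' / a \<in> squares" (is "_ \<longleftrightarrow> ?R")
proof -
  interpret L: sqrt_basis \<iota> \<alpha> \<beta> a b by fact
  interpret L': sqrt_basis \<iota>' \<alpha>' \<beta>' a' b' by fact
  have nz: "a \<noteq> 0" "b \<noteq> 0" "a * b \<noteq> 0" using L.a_neq_zero L.b_neq_zero by auto
  note sq_iff = mem_squares_divide_iff[OF nz(1)] mem_squares_divide_iff[OF nz(2)]
    mem_squares_divide_iff[OF nz(3)]
  show ?thesis
  proof
    assume "ext_isomorphic \<iota> \<iota>'"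
    then obtain \<phi> where "field_isom \<phi>" and \<phi>: "\<And>c. \<phi> (\<iota> c) = \<iota>' c"
      unfolding ext_isomorphic_def by blast
    interpret field_isom \<phi> by fact
    have inv_\<phi>: "inv_into UNIV \<phi> (\<iota>' c) = \<iota> c" for c by (simp flip: \<phi>)
    have "inv_into UNIV \<phi> \<alpha>' ^ 2 = \<iota> a'" "inv_into UNIV \<phi> \<beta>' ^ 2 = \<iota> b'"
      by (simp_all flip: inv.hom_power add: L'.alpha_sq L'.beta_sq inv_\<phi>)
    with L'.a_not_square L'.b_not_square
    have a': "a' / a \<in> squares \<or> a' / b \<in> squares \<or> a' / (a * b) \<in> squares"
      and b': "b' / a \<in> squares \<or> b' / b \<in> squares \<or> b' / (a * b) \<in> squares"
      unfolding sq_iff by (metis L.sqrt_class)+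
    \<comment> \<open>A shared class would make \<open>a' * b'\<close> a square, so the two classes
      differ.\<close>
    have "\<not> (a' / d \<in> squares \<and> b' / d \<in> squares)" if d: "d \<noteq> 0" for d
    proof
      assume "a' / d \<in> squares \<and> b' / d \<in> squares"
      then obtain s t where "a' = d * s ^ 2" "b' = d * t ^ 2"
        unfolding mem_squares_divide_iff[OF d] by blast
      then have "a' * b' = (d * s * t) ^ 2" by (simp add: power2_eq_square)
      then show False using L'.ab_not_square by blast
    qed
    then show ?R using a' b' nz by blast
  next
    assume R: ?R
    define S where "S d \<longleftrightarrow> (\<exists>x. x ^ 2 = \<iota>' d)" for d
    have S_of_class: "S d" if "c / d \<in> squares" "x ^ 2 = \<iota>' c" "c \<noteq> 0" "d \<noteq> 0" for c d x
    proof -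
      obtain t where t: "c = d * t ^ 2" using \<open>c / d \<in> squares\<close> mem_squares_divide_iff[OF \<open>d \<noteq> 0\<close>] by blast
      then have "(x / \<iota>' t) ^ 2 = \<iota>' d"
        \<comment> \<open>\<open>c \<noteq> 0\<close> ensures that the divisor \<open>t\<close> is
          nonzero.\<close>
        using that(2,3) by (auto simp: power_divide L'.hom_mult L'.hom_power)
      then show ?thesis unfolding S_def by blast
    qed
    have Sa: "S d" if "a' / d \<in> squares" "d \<noteq> 0" for d
      using S_of_class[OF that(1) L'.alpha_sq L'.a_neq_zero that(2)] .
    have Sb: "S d" if "b' / d \<in> squares" "d \<noteq> 0" for d
      using S_of_class[OF that(1) L'.beta_sq L'.b_neq_zero that(2)] .
    have S_quot: "S d" if "S c" "S (c * d)" "c \<noteq> 0" for c d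
    proof -
      obtain x x' where "x ^ 2 = \<iota>' c" "x' ^ 2 = \<iota>' (c * d)" using \<open>S c\<close> \<open>S (c * d)\<close> unfolding S_def by blast
      then have "(x' / x) ^ 2 = \<iota>' d" using \<open>c \<noteq> 0\<close> by (simp add: power_divide L'.hom_mult)
      then show ?thesis unfolding S_def by blast
    qed
    \<comment> \<open>Any two of the three classes yield the third. The order \<open>b * a\<close>
      fits \<open>S_quot\<close>, which strips the left factor.\<close>
    have two: "S a \<and> S b \<or> S a \<and> S (a * b) \<or> S b \<and> S (b * a)"
      using R Sa Sb nz by (metis mult.commute)
    then have "S a \<and> S b" using S_quot nz by blast
    then obtain A B where AB: "A ^ 2 = \<iota>' a" "B ^ 2 = \<iota>' b" unfolding S_def by blast
    obtain \<phi> where "field_hom \<phi>" and \<phi>: "\<And>c. \<phi> (\<iota> c) = \<iota>' c"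
      using L.hom_extension[OF L'.field_hom_axioms AB] by blast
    interpret field_hom \<phi> by fact
    \<comment> \<open>Two elements with equal squares agree up to sign, and the range is closed
      under negation.\<close>
    have sqrt_in_range: "x \<in> range \<phi>" if "x ^ 2 = \<iota>' c" "x0 ^ 2 = \<iota> d" "c = d * t ^ 2" for x x0 c d t
    proof -
      have "\<phi> (\<iota> t * x0) ^ 2 = x ^ 2"
        unfolding that(1,3) using arg_cong[OF that(2), of \<phi>]
        by (simp add: hom_mult hom_power power_mult_distrib \<phi> L'.hom_mult L'.hom_power)
      then have "x = \<phi> (\<iota> t * x0) \<or> x = \<phi> (- (\<iota> t * x0))"
        unfolding hom_uminus by (metis power2_eq_iff)
      then show ?thesis by blast
    qed
    have ab_sq: "(\<alpha> * \<beta>) ^ 2 = \<iota> (a * b)"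
      by (simp add: power_mult_distrib L.alpha_sq L.beta_sq L.hom_mult)
    have "\<alpha>' \<in> range \<phi>"
      using R sqrt_in_range[OF L'.alpha_sq L.alpha_sq] sqrt_in_range[OF L'.alpha_sq L.beta_sq]
        sqrt_in_range[OF L'.alpha_sq ab_sq] unfolding sq_iff by blast
    moreover have "\<beta>' \<in> range \<phi>"
      using R sqrt_in_range[OF L'.beta_sq L.alpha_sq] sqrt_in_range[OF L'.beta_sq L.beta_sq]
        sqrt_in_range[OF L'.beta_sq ab_sq] unfolding sq_iff by blast
    ultimately obtain X Y where XY: "\<alpha>' = \<phi> X" "\<beta>' = \<phi> Y" by blast
    have "x \<in> range \<phi>" for x
    proof -
      obtain p q r s where "x = \<iota>' p + \<iota>' q * \<alpha>' + \<iota>' r * \<beta>' + \<iota>' s * (\<alpha>' * \<beta>')"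
        using L'.span[of x] by blast
      then have "x = \<phi> (\<iota> p + \<iota> q * X + \<iota> r * Y + \<iota> s * (X * Y))"
        by (simp add: XY hom_add hom_mult \<phi>)
      then show ?thesis by blast
    qed
    then have "surj \<phi>" by blast
    then have "field_isom \<phi>" by unfold_locales auto
    then show "ext_isomorphic \<iota> \<iota>'" unfolding ext_isomorphic_def using \<phi> by blast
  qed
qed

theorem theorem3p8:
  fixes \<iota> :: "'f::field \<Rightarrow> 'l::field" and \<iota>' :: "'f \<Rightarrow> 'm::field"
    and y :: 'l and y' :: 'm and u w v z :: 'f
  assumes "CHAR('f) \<noteq> 2"
    and "field_hom \<iota>" and "elementary_abelian_ext \<iota>"
    and "biquadratic_generator \<iota> y" and "is_min_poly \<iota> y [:w^2, 0, u, 0, 1:]"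
    and "field_hom \<iota>'" and "biquadratic_ext \<iota>'"
    and "biquadratic_generator \<iota>' y'" and "is_min_poly \<iota>' y' [:z^2, 0, v, 0, 1:]"
  shows "ext_isomorphic \<iota> \<iota>' \<longleftrightarrow>
      (- v - 2 * z) / (- u + 2 * w) \<in> squares \<and> (- v + 2 * z) / (- u - 2 * w) \<in> squares
    \<or> (- v - 2 * z) / (- u + 2 * w) \<in> squares \<and> (- v + 2 * z) / (u^2 - 4 * w^2) \<in> squares
    \<or> (- v - 2 * z) / (- u - 2 * w) \<in> squares \<and> (- v + 2 * z) / (- u + 2 * w) \<in> squares
    \<or> (- v - 2 * z) / (- u - 2 * w) \<in> squares \<and> (- v + 2 * z) / (u^2 - 4 * w^2) \<in> squares
    \<or> (- v - 2 * z) / (u^2 - 4 * w^2) \<in> squares \<and> (- v + 2 * z) / (- u - 2 * w) \<in> squares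
    \<or> (- v - 2 * z) / (u^2 - 4 * w^2) \<in> squares \<and> (- v + 2 * z) / (- u + 2 * w) \<in> squares"
proof -
  have two: "(2 :: 'f) \<noteq> 0" using two_neq_zero_if_CHAR assms(1) .
  have basis: "sqrt_basis \<iota> (y + \<iota> w / y) (y - \<iota> w / y) (- u + 2 * w) (- u - 2 * w)"
    using sqrt_basis_of_min_poly[OF two] assms unfolding biquadratic_generator_def by blast
  \<comment> \<open>Here \<open>b'\<close> is \<open>- v - 2 * z\<close>, the first numerator in
    each condition.\<close>
  have basis': "sqrt_basis \<iota>' (y' + \<iota>' z / y') (y' - \<iota>' z / y') (- v + 2 * z) (- v - 2 * z)"
    using sqrt_basis_of_min_poly[OF two] assms unfolding biquadratic_generator_def by blast
  \<comment> \<open>The third denominator represents the class of \<open>a * b\<close>.\<close>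
  have "(- u + 2 * w) * (- u - 2 * w) = u^2 - 4 * w^2"
    by (simp add: algebra_simps power2_eq_square)
  then show ?thesis using ext_isomorphic_iff_square_classes[OF basis basis'] by simp
qed

end
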